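(* Let $[H,G]$ be a Boolean interval of finite groups. If it is group-complemented, then $\hat{\varphi}(H,G) > 0$.
   Context: An interval of finite groups $[H,G]$ is the lattice of all subgroups $K$ with $H \subseteq K \subseteq G$, where $G$ is a finite group and $H$ a subgroup. It is Boolean if it is isomorphic to the lattice of subsets of a finite set; then each $K \in [H,G]$ has a unique lattice-complement $K^{\complement}$. A Boolean interval is group-complemented if $KK^{\complement} = G$ (as a product set) for every $K \in [H,G]$. The dual Euler totient is $\hat{\varphi}(H,G) := \sum_{K \in [H,G]} \mu(H,K)\,|G:K|$, with $\mu$ the Möbius function of the lattice $[H,G]$. *)

theory Defs
  imports "HOL-Algebra.Algebra"
begin

section \<open>Order-theoretic notions\<close>

text \<open>
  The finite set may be taken to consist of natural numbers, since the lattice of subsets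
  only depends on the cardinality. A bijective order embedding is the same thing as a lattice
  isomorphism.
\<close>

definition boolean_lattice :: "('a, 'b) gorder_scheme \<Rightarrow> bool" where
  "boolean_lattice L \<longleftrightarrow>
     (\<exists>(S :: nat set) f. finite S \<and> bij_betw f (carrier L) (Pow S) \<and>
        order_emb L \<lparr>carrier = Pow S, eq = (=), le = (\<subseteq>)\<rparr> f)"

definition is_lattice_complement :: "('a, 'b) gorder_scheme \<Rightarrow> 'a \<Rightarrow> 'a \<Rightarrow> bool" where
  "is_lattice_complement L x y \<longleftrightarrow>
     y \<in> carrier L \<and> x \<sqinter>\<^bsub>L\<^esub> y = \<bottom>\<^bsub>L\<^esub> \<and> x \<squnion>\<^bsub>L\<^esub> y = \<top>\<^bsub>L\<^esub>"

text \<open>Well-defined on Boolean lattices, see \<open>boolean_lattice_ex1_complement\<close> below.\<close>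

definition lattice_complement :: "('a, 'b) gorder_scheme \<Rightarrow> 'a \<Rightarrow> 'a" where
  "lattice_complement L x = (THE y. is_lattice_complement L x y)"

text \<open>
  The Moebius function of a finite partial order, given by its usual recursion; it is \<open>0\<close>
  on pairs \<open>x\<close>, \<open>y\<close> without \<open>x \<sqsubseteq> y\<close>.
\<close>

function moebius :: "('a, 'b) gorder_scheme \<Rightarrow> 'a \<Rightarrow> 'a \<Rightarrow> int" where
  "moebius L x y =
     (if partial_order L \<and> finite (carrier L) \<and> x \<in> carrier L \<and> y \<in> carrier L \<and> x \<sqsubseteq>\<^bsub>L\<^esub> y
      then if x = y then 1
           else - (\<Sum>z \<in> {z \<in> carrier L. x \<sqsubseteq>\<^bsub>L\<^esub> z \<and> z \<sqsubset>\<^bsub>L\<^esub> y}. moebius L x z)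
      else 0)"
  by pat_completeness auto
termination
proof (relation "measure (\<lambda>(L, x, y). card {z \<in> carrier L. z \<sqsubset>\<^bsub>L\<^esub> y})", goal_cases)
  case 1
  then show ?case by simp
next
  case (2 L x y z)
  interpret partial_order L using 2 by blast
  have z: "z \<in> carrier L" "z \<sqsubset>\<^bsub>L\<^esub> y" and y: "y \<in> carrier L" using 2 by auto
  have "{w \<in> carrier L. w \<sqsubset>\<^bsub>L\<^esub> z} \<subseteq> {w \<in> carrier L. w \<sqsubset>\<^bsub>L\<^esub> y}"
    using z y lless_trans by blast
  moreover have "z \<in> {w \<in> carrier L. w \<sqsubset>\<^bsub>L\<^esub> y}" "z \<notin> {w \<in> carrier L. w \<sqsubset>\<^bsub>L\<^esub> z}"
    using z by (auto simp: lless_def)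
  ultimately have "{w \<in> carrier L. w \<sqsubset>\<^bsub>L\<^esub> z} \<subset> {w \<in> carrier L. w \<sqsubset>\<^bsub>L\<^esub> y}"
    by blast
  moreover have "finite {w \<in> carrier L. w \<sqsubset>\<^bsub>L\<^esub> y}" using 2 by auto
  ultimately show ?case by (simp add: psubset_card_mono)
qed

declare moebius.simps [simp del]

lemma boolean_lattice_ex1_complement:
  assumes "boolean_lattice L" and x: "x \<in> carrier L"
  shows "\<exists>!y. is_lattice_complement L x y"
proof -
  obtain S :: "nat set" and f where
    bij: "bij_betw f (carrier L) (Pow S)" and
    emb: "order_emb L \<lparr>carrier = Pow S, eq = (=), le = (\<subseteq>)\<rparr> f"
    using assms(1) by (auto simp: boolean_lattice_def)
  have le: "a \<sqsubseteq>\<^bsub>L\<^esub> b \<longleftrightarrow> f a \<subseteq> f b" if "a \<in> carrier L" "b \<in> carrier L" for a b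
    using emb that by (auto simp: order_emb_def)
  have inj: "a = b" if "a \<in> carrier L" "b \<in> carrier L" "f a = f b" for a b
    using bij that by (meson bij_betw_imp_inj_on inj_onD)
  have sub: "f a \<subseteq> S" if "a \<in> carrier L" for a
    using bij that by (meson PowD bij_betwE)
  have surj: "\<exists>a \<in> carrier L. f a = T" if "T \<subseteq> S" for T
    using bij that by (metis PowI bij_betw_imp_surj_on imageE)
  have least: "least L a A \<longleftrightarrow> a \<in> A \<and> (\<forall>b\<in>A. f a \<subseteq> f b)"
    and greatest: "greatest L a A \<longleftrightarrow> a \<in> A \<and> (\<forall>b\<in>A. f b \<subseteq> f a)"
    if "A \<subseteq> carrier L" for a A
    using that le by (meson least_def greatest_def subsetD)+
  have someL: "(SOME l. least L l A) \<in> carrier L \<and> f (SOME l. least L l A) = f e"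
    if e: "least L e A" for e A
  proof -
    have A: "A \<subseteq> carrier L" using e by (simp add: least_def)
    have "least L (SOME l. least L l A) A" using e by (rule someI)
    then show ?thesis using e A unfolding least[OF A] by blast
  qed
  have someG: "(SOME l. greatest L l A) \<in> carrier L \<and> f (SOME l. greatest L l A) = f e"
    if e: "greatest L e A" for e A
  proof -
    have A: "A \<subseteq> carrier L" using e by (simp add: greatest_def)
    have "greatest L (SOME l. greatest L l A) A" using e by (rule someI)
    then show ?thesis using e A unfolding greatest[OF A] by blast
  qed
  have bot: "\<bottom>\<^bsub>L\<^esub> \<in> carrier L \<and> f \<bottom>\<^bsub>L\<^esub> = {}"
  proof -
    obtain e where e: "e \<in> carrier L" "f e = {}" using surj by blast
    then have "least L e (carrier L)" by (simp add: least)
    from someL[OF this] show ?thesis using e by (simp add: bottom_def)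
  qed
  have top: "\<top>\<^bsub>L\<^esub> \<in> carrier L \<and> f \<top>\<^bsub>L\<^esub> = S"
  proof -
    obtain e where e: "e \<in> carrier L" "f e = S" using surj by blast
    then have "greatest L e (carrier L)" by (simp add: greatest sub)
    from someG[OF this] show ?thesis using e by (simp add: top_def)
  qed
  have meet: "x \<sqinter>\<^bsub>L\<^esub> y \<in> carrier L \<and> f (x \<sqinter>\<^bsub>L\<^esub> y) = f x \<inter> f y" if y: "y \<in> carrier L" for y
  proof -
    have L: "Lower L {x, y} = {b \<in> carrier L. f b \<subseteq> f x \<inter> f y}"
      using x y le by (auto simp: Lower_def)
    obtain e where e: "e \<in> carrier L" "f e = f x \<inter> f y" using surj sub x by (meson le_infI1)
    then have "greatest L e (Lower L {x, y})" unfolding L by (subst greatest) auto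
    from someG[OF this] show ?thesis
      using e by (simp add: meet_def inf_def)
  qed
  have join: "x \<squnion>\<^bsub>L\<^esub> y \<in> carrier L \<and> f (x \<squnion>\<^bsub>L\<^esub> y) = f x \<union> f y" if y: "y \<in> carrier L" for y
  proof -
    have U: "Upper L {x, y} = {b \<in> carrier L. f x \<union> f y \<subseteq> f b}"
      using x y le by (auto simp: Upper_def)
    obtain e where e: "e \<in> carrier L" "f e = f x \<union> f y" using surj sub x y by (meson Un_least)
    then have "least L e (Upper L {x, y})" unfolding U by (subst least) auto
    from someL[OF this] show ?thesis
      using e by (simp add: join_def sup_def)
  qed
  have "is_lattice_complement L x y \<longleftrightarrow> y \<in> carrier L \<and> f y = S - f x" for y
  proof (cases "y \<in> carrier L")
    case True
    have "x \<sqinter>\<^bsub>L\<^esub> y = \<bottom>\<^bsub>L\<^esub> \<longleftrightarrow> f x \<inter> f y = {}"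
      using meet[OF True] bot inj by metis
    moreover have "x \<squnion>\<^bsub>L\<^esub> y = \<top>\<^bsub>L\<^esub> \<longleftrightarrow> f x \<union> f y = S"
      using join[OF True] top inj by metis
    ultimately show ?thesis
      using True sub[OF x] sub[OF True] by (auto simp: is_lattice_complement_def)
  qed (auto simp: is_lattice_complement_def)
  then show ?thesis using surj[of "S - f x"] inj by (metis Diff_subset)
qed


section \<open>Intervals of groups\<close>

definition group_interval :: "'a set \<Rightarrow> ('a, 'b) monoid_scheme \<Rightarrow> 'a set gorder" where
  "group_interval H G = \<lparr>carrier = {K. subgroup K G \<and> H \<subseteq> K}, eq = (=), le = (\<subseteq>)\<rparr>"

definition group_complemented :: "'a set \<Rightarrow> ('a, 'b) monoid_scheme \<Rightarrow> bool" where
  "group_complemented H G \<longleftrightarrow>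
     (\<forall>K \<in> carrier (group_interval H G).
        K <#>\<^bsub>G\<^esub> lattice_complement (group_interval H G) K = carrier G)"

definition dual_totient :: "'a set \<Rightarrow> ('a, 'b) monoid_scheme \<Rightarrow> int" where
  "dual_totient H G =
     (\<Sum>K \<in> carrier (group_interval H G).
        moebius (group_interval H G) H K * int (card (rcosets\<^bsub>G\<^esub> K)))"

end

theory Submission
  imports Defs
begin

text \<open>
  Group-complementedness turns \<open>|H| |G:K|\<close> into \<open>|K\<^sup>\<complement>|\<close>. Counting elements,
  \<open>|H|\<close> times the dual totient becomes the sum over \<open>g \<in> G\<close> of the sum of the \<open>\<mu>(H,K)\<close> with
  \<open>\<langle>H,g\<rangle> \<le> K\<^sup>\<complement>\<close>, that is, with \<open>K \<le> \<langle>H,g\<rangle>\<^sup>\<complement>\<close>. The inner sum is \<open>1\<close> if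
  \<open>\<langle>H,g\<rangle> = G\<close> and \<open>0\<close> otherwise, so the totient is positive iff some \<open>g\<close> generates \<open>G\<close> together
  with \<open>H\<close>. Such a \<open>g\<close> exists by Ore's theorem: if \<open>\<langle>H,a\<rangle>\<close> and \<open>\<langle>H,b\<rangle>\<close> are complements
  and \<open>g = a b\<close>, then by distributivity
  \<open>\<langle>H,g\<rangle> = \<langle>H,g\<rangle> \<or> (\<langle>H,a\<rangle> \<and> \<langle>H,b\<rangle>) = \<langle>H,g,a\<rangle> \<and> \<langle>H,g,b\<rangle> = G\<close>.
\<close>

section \<open>Two general tools: Moebius sums over an interval, and the size of a product
  set\<close>

text \<open>Split off the term \<open>z = y\<close>. For \<open>x \<noteq> y\<close> the recursion
  makes it cancel the strict sum; for \<open>x = y\<close> antisymmetry leaves the strict sum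
  empty.\<close>

lemma sum_moebius:
  assumes "partial_order L" "finite (carrier L)" "x \<in> carrier L" "y \<in> carrier L" "x \<sqsubseteq>\<^bsub>L\<^esub> y"
  shows "(\<Sum>z | z \<in> carrier L \<and> x \<sqsubseteq>\<^bsub>L\<^esub> z \<and> z \<sqsubseteq>\<^bsub>L\<^esub> y. moebius L x z) = (if x = y then 1 else 0)"
proof -
  interpret partial_order L by fact
  have "{z. z \<in> carrier L \<and> x \<sqsubseteq>\<^bsub>L\<^esub> z \<and> z \<sqsubseteq>\<^bsub>L\<^esub> y} =
      insert y {z \<in> carrier L. x \<sqsubseteq>\<^bsub>L\<^esub> z \<and> z \<sqsubset>\<^bsub>L\<^esub> y}"
    using assms by (auto simp: lless_def eq_is_equal)
  moreover have "y \<notin> {z \<in> carrier L. x \<sqsubseteq>\<^bsub>L\<^esub> z \<and> z \<sqsubset>\<^bsub>L\<^esub> y}"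
    by (auto simp: lless_def eq_is_equal)
  moreover have "(\<Sum>z \<in> {z \<in> carrier L. x \<sqsubseteq>\<^bsub>L\<^esub> z \<and> z \<sqsubset>\<^bsub>L\<^esub> y}. moebius L x z) = 0" if "x = y"
    using that assms by (auto simp: lless_def eq_is_equal intro!: sum.neutral intro: le_antisym)
  ultimately show ?thesis
    using assms by (simp add: moebius.simps[of L x y])
qed

text \<open>Multiplication maps \<open>K \<times> L\<close> onto \<open>K <#> L\<close>, and the
  fiber over \<open>a \<otimes> b\<close> consists of the pairs
  \<open>(a \<otimes> d, inv d \<otimes> b)\<close> with \<open>d\<close> in
  \<open>K \<inter> L\<close>, so all fibers have the same size.\<close>

lemma (in group) card_subgroup_product:
  assumes K: "subgroup K G" and L: "subgroup L G" and fin: "finite K" "finite L"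
  shows "card K * card L = card (K <#> L) * card (K \<inter> L)"
proof -
  interpret K: subgroup K G by fact
  interpret L: subgroup L G by fact
  let ?m = "\<lambda>(k, l). k \<otimes> l"
  have fiber: "card {p \<in> K \<times> L. ?m p = g} = card (K \<inter> L)" if g: "g \<in> ?m ` (K \<times> L)" for g
  proof -
    obtain a b where ab: "a \<in> K" "b \<in> L" "g = a \<otimes> b" using g by auto
    have "bij_betw (\<lambda>d. (a \<otimes> d, inv d \<otimes> b)) (K \<inter> L) {p \<in> K \<times> L. ?m p = g}"
    proof (rule bij_betw_byWitness[where f' = "\<lambda>(k, l). inv a \<otimes> k"])
      show "\<forall>d\<in>K \<inter> L. (case (a \<otimes> d, inv d \<otimes> b) of (k, l) \<Rightarrow> inv a \<otimes> k) = d"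
        using ab by (auto simp: inv_solve_left m_assoc[symmetric])
      \<comment> \<open>The parameter \<open>d\<close> is recovered from a pair in the fiber as
        \<open>inv a \<otimes> k\<close>, which lies in \<open>K\<close>; its second form
        \<open>b \<otimes> inv l\<close> shows that it also lies in \<open>L\<close>.\<close>
      have 1: "a \<otimes> (inv a \<otimes> k) = k \<and> inv (inv a \<otimes> k) \<otimes> b = l \<and> inv a \<otimes> k = b \<otimes> inv l"
        if "k \<in> K" "l \<in> L" "k \<otimes> l = g" for k l
      proof -
        have [simp]: "k \<in> carrier G" "l \<in> carrier G" "a \<in> carrier G" "b \<in> carrier G"
          using that ab by auto
        have "k = k \<otimes> l \<otimes> inv l" by (simp add: m_assoc)
        also have "\<dots> = a \<otimes> (b \<otimes> inv l)" using that ab by (simp add: m_assoc)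
        finally have "inv a \<otimes> k = inv a \<otimes> (a \<otimes> (b \<otimes> inv l))" by simp
        also have "\<dots> = b \<otimes> inv l" by (simp flip: m_assoc)
        finally have "inv a \<otimes> k = b \<otimes> inv l" .
        moreover have "inv (b \<otimes> inv l) \<otimes> b = l"
          by (simp add: inv_mult_group m_assoc)
        moreover have "a \<otimes> (inv a \<otimes> k) = k" by (simp add: m_assoc[symmetric])
        ultimately show ?thesis by simp
      qed
      show "\<forall>p\<in>{p \<in> K \<times> L. ?m p = g}. (a \<otimes> (case p of (k, l) \<Rightarrow> inv a \<otimes> k),
          inv (case p of (k, l) \<Rightarrow> inv a \<otimes> k) \<otimes> b) = p"
        using 1 by auto
      show "(\<lambda>d. (a \<otimes> d, inv d \<otimes> b)) ` (K \<inter> L) \<subseteq> {p \<in> K \<times> L. ?m p = g}"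
      proof (rule image_subsetI)
        fix d assume "d \<in> K \<inter> L"
        then have d: "d \<in> K" "d \<in> L" by auto
        then have [simp]: "d \<in> carrier G" "a \<in> carrier G" "b \<in> carrier G" using ab by auto
        have "d \<otimes> (inv d \<otimes> b) = b" by (simp add: m_assoc[symmetric])
        then show "(a \<otimes> d, inv d \<otimes> b) \<in> {p \<in> K \<times> L. ?m p = g}"
          using d ab by (simp add: m_assoc)
      qed
      show "(\<lambda>(k, l). inv a \<otimes> k) ` {p \<in> K \<times> L. ?m p = g} \<subseteq> K \<inter> L"
      proof (rule image_subsetI)
        fix p assume "p \<in> {p \<in> K \<times> L. ?m p = g}"
        then obtain k l where kl: "p = (k, l)" "k \<otimes> l = g" "k \<in> K" "l \<in> L" by auto
        then have "inv a \<otimes> k = b \<otimes> inv l" using 1 by blast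
        moreover have "inv a \<otimes> k \<in> K" "b \<otimes> inv l \<in> L" using kl ab by auto
        ultimately show "(\<lambda>(k, l). inv a \<otimes> k) p \<in> K \<inter> L" using kl by simp
      qed
    qed
    then show ?thesis by (rule bij_betw_same_card[symmetric])
  qed
  have "card K * card L = (\<Sum>p\<in>K \<times> L. 1)" by (simp add: card_cartesian_product)
  also have "\<dots> = (\<Sum>g\<in>?m ` (K \<times> L). card {p \<in> K \<times> L. ?m p = g})"
    using fin by (subst sum.image_gen[where g = ?m]) auto
  also have "\<dots> = card (?m ` (K \<times> L)) * card (K \<inter> L)" using fiber by simp
  also have "?m ` (K \<times> L) = K <#> L" by (auto simp: set_mult_def)
  finally show ?thesis .
qed

section \<open>The interval seen through subsets of \<open>S\<close>\<close>

lemma carrier_group_interval: "K \<in> carrier (group_interval H G) \<longleftrightarrow> subgroup K G \<and> H \<subseteq> K"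
  by (simp add: group_interval_def)

lemma le_group_interval: "K \<sqsubseteq>\<^bsub>group_interval H G\<^esub> L \<longleftrightarrow> K \<subseteq> L"
  by (simp add: group_interval_def)

lemma partial_order_group_interval: "partial_order (group_interval H G)"
  by unfold_locales (auto simp: group_interval_def)

text \<open>Fixing one isomorphism \<open>f\<close> reduces inclusions, meets, joins and complements
  in the interval to set algebra inside \<open>S\<close>.\<close>

locale boolean_group_interval = group G for G :: "('a, 'b) monoid_scheme" (structure) +
  fixes H :: "'a set" and S :: "nat set" and f :: "'a set \<Rightarrow> nat set"
  assumes finite_carrier: "finite (carrier G)"
    and subgroup_H: "subgroup H G"
    and finite_S: "finite S"
    and f_bij: "bij_betw f (carrier (group_interval H G)) (Pow S)"
    and f_emb: "order_emb (group_interval H G) \<lparr>carrier = Pow S, eq = (=), le = (\<subseteq>)\<rparr> f"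
begin

abbreviation "I \<equiv> group_interval H G"

sublocale I: partial_order I by (rule partial_order_group_interval)

lemma boolean: "boolean_lattice I"
  unfolding boolean_lattice_def using finite_S f_bij f_emb by blast

lemma f_mono_iff: "K \<in> carrier I \<Longrightarrow> L \<in> carrier I \<Longrightarrow> f K \<subseteq> f L \<longleftrightarrow> K \<subseteq> L"
  using f_emb by (auto simp: order_emb_def le_group_interval)

lemma f_eq_iff: "K \<in> carrier I \<Longrightarrow> L \<in> carrier I \<Longrightarrow> f K = f L \<longleftrightarrow> K = L"
  using f_mono_iff by (metis subset_antisym subset_refl)

lemma f_subset: "K \<in> carrier I \<Longrightarrow> f K \<subseteq> S"
  using f_bij by (meson PowD bij_betwE)

lemma f_surj:
  assumes "T \<subseteq> S" obtains K where "K \<in> carrier I" "f K = T"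
  using f_bij assms by (metis PowI bij_betw_imp_surj_on imageE)

lemma H_in_I: "H \<in> carrier I"
  using subgroup_H by (simp add: carrier_group_interval)

lemma G_in_I: "carrier G \<in> carrier I"
  using subgroup_H by (simp add: carrier_group_interval subgroup_self subgroup.subset)

lemma f_H: "f H = {}"
proof -
  obtain K where K: "K \<in> carrier I" "f K = {}" using f_surj by blast
  then have "H \<subseteq> K" by (simp add: carrier_group_interval)
  then show ?thesis using K H_in_I f_mono_iff by blast
qed

lemma f_G: "f (carrier G) = S"
proof -
  obtain K where K: "K \<in> carrier I" "f K = S" using f_surj by blast
  then have "K \<subseteq> carrier G" by (simp add: carrier_group_interval subgroup.subset)
  then show ?thesis using K G_in_I f_mono_iff f_subset by blast
qed

lemma Int_in_I: "K \<in> carrier I \<Longrightarrow> L \<in> carrier I \<Longrightarrow> K \<inter> L \<in> carrier I"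
  by (simp add: carrier_group_interval subgroups_Inter_pair)

lemma f_Int:
  assumes K: "K \<in> carrier I" and L: "L \<in> carrier I"
  shows "f (K \<inter> L) = f K \<inter> f L"
proof -
  obtain M where M: "M \<in> carrier I" "f M = f K \<inter> f L"
    using f_surj[of "f K \<inter> f L"] f_subset[OF K] by blast
  then have "M \<subseteq> K \<inter> L" using K L by (metis f_mono_iff inf.bounded_iff subset_refl)
  then have "f K \<inter> f L \<subseteq> f (K \<inter> L)" using M f_mono_iff Int_in_I K L by metis
  moreover have "f (K \<inter> L) \<subseteq> f K \<inter> f L" using f_mono_iff Int_in_I K L by simp
  ultimately show ?thesis by blast
qed

lemma meet_I:
  assumes "K \<in> carrier I" "L \<in> carrier I"
  shows "K \<sqinter>\<^bsub>I\<^esub> L = K \<inter> L"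
proof -
  have "greatest I (K \<inter> L) (Lower I {K, L})"
    using assms Int_in_I by (auto simp: greatest_def Lower_def le_group_interval)
  then show ?thesis unfolding meet_def inf_def by (metis some_equality I.greatest_unique)
qed

lemma f_join_I:
  assumes K: "K \<in> carrier I" and L: "L \<in> carrier I"
  shows "f (K \<squnion>\<^bsub>I\<^esub> L) = f K \<union> f L"
proof -
  \<comment> \<open>A union of subgroups need not be a subgroup, so the candidate for the join is
    pulled back along the surjection \<open>f\<close>.\<close>
  obtain M where M: "M \<in> carrier I" "f M = f K \<union> f L"
    using f_surj[of "f K \<union> f L"] f_subset K L by blast
  have "M \<subseteq> N \<longleftrightarrow> K \<subseteq> N \<and> L \<subseteq> N" if "N \<in> carrier I" for N
    using M K L that by (simp flip: f_mono_iff)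
  then have "least I M (Upper I {K, L})"
    using M K L by (auto simp: least_def Upper_def le_group_interval)
  then have "K \<squnion>\<^bsub>I\<^esub> L = M" unfolding join_def sup_def by (metis some_equality I.least_unique)
  with M show ?thesis by simp
qed

lemma bottom_I: "\<bottom>\<^bsub>I\<^esub> = H"
proof -
  have "least I H (carrier I)"
    using H_in_I by (auto simp: least_def le_group_interval carrier_group_interval)
  then show ?thesis unfolding bottom_def by (metis some_equality I.least_unique)
qed

lemma top_I: "\<top>\<^bsub>I\<^esub> = carrier G"
proof -
  have "greatest I (carrier G) (carrier I)"
    using G_in_I by (auto simp: greatest_def le_group_interval carrier_group_interval
        dest!: subgroup.subset)
  then show ?thesis unfolding top_def by (metis some_equality I.greatest_unique)
qed

abbreviation "compl \<equiv> lattice_complement I"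

lemma
  assumes K: "K \<in> carrier I"
  shows compl_in_I: "compl K \<in> carrier I"
    and Int_compl: "K \<inter> compl K = H"
    and f_compl: "f (compl K) = S - f K"
proof -
  have *: "is_lattice_complement I K (compl K)"
    unfolding lattice_complement_def
    by (rule theI') (rule boolean_lattice_ex1_complement[OF boolean K])
  then show C: "compl K \<in> carrier I" by (simp add: is_lattice_complement_def)
  show H: "K \<inter> compl K = H"
    using * meet_I[OF K C] by (simp add: is_lattice_complement_def bottom_I)
  have "f K \<inter> f (compl K) = {}" using f_Int[OF K C] H f_H by simp
  moreover have "f K \<union> f (compl K) = S"
    using * f_join_I[OF K C] f_G by (simp add: is_lattice_complement_def top_I)
  ultimately show "f (compl K) = S - f K" by blast
qed

text \<open>Both sides say that \<open>f K\<close> and \<open>f L\<close> are disjoint. This turns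
  the condition \<open>g \<in> compl K\<close> into an upper bound on \<open>K\<close>, as a Moebius
  sum requires.\<close>

lemma le_compl_iff:
  assumes "K \<in> carrier I" "L \<in> carrier I"
  shows "L \<subseteq> compl K \<longleftrightarrow> K \<subseteq> compl L"
proof -
  have "f L \<subseteq> S - f K \<longleftrightarrow> f K \<subseteq> S - f L" using f_subset assms by blast
  then show ?thesis using assms by (metis compl_in_I f_compl f_mono_iff)
qed

lemma compl_eq_H_iff:
  assumes "K \<in> carrier I"
  shows "compl K = H \<longleftrightarrow> K = carrier G"
proof -
  have "compl K = H \<longleftrightarrow> S - f K = {}"
    using assms by (metis compl_in_I f_compl f_H f_eq_iff H_in_I)
  also have "\<dots> \<longleftrightarrow> f K = f (carrier G)" using f_subset[OF assms] f_G by blast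
  finally show ?thesis using assms by (simp add: f_eq_iff G_in_I)
qed

section \<open>Generation over \<open>H\<close> by one element\<close>

text \<open>For \<open>g\<close> in \<open>carrier G\<close> this is the least member of the
  interval that contains \<open>g\<close>.\<close>

definition gen :: "'a \<Rightarrow> 'a set" where "gen g = generate G (insert g H)"

lemma gen_in_I: "g \<in> carrier G \<Longrightarrow> gen g \<in> carrier I"
  unfolding gen_def carrier_group_interval
  using generate_is_subgroup[of "insert g H"] subgroup.subset[OF subgroup_H]
  by (auto intro: generate.incl)

lemma gen_subset_iff:
  assumes "K \<in> carrier I"
  shows "gen g \<subseteq> K \<longleftrightarrow> g \<in> K"
proof -
  have "insert g H \<subseteq> gen g" unfolding gen_def by (auto intro: generate.incl)
  moreover have "gen g \<subseteq> K" if "g \<in> K"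
    unfolding gen_def using assms that
    by (intro generate_subgroup_incl) (auto simp: carrier_group_interval)
  ultimately show ?thesis by blast
qed

text \<open>Ore's theorem for every member \<open>K\<close> of the interval, not only for the whole
  group: the induction removes one atom at a time and so passes through smaller subgroups.\<close>

lemma gen_surj:
  assumes "finite T" "K \<in> carrier I" "f K = T"
  shows "\<exists>g \<in> K. gen g = K"
  using assms
proof (induction T arbitrary: K)
  case empty
  then have "K = H" using f_H f_eq_iff H_in_I by blast
  moreover have one: "\<one> \<in> H" using subgroup_H by (rule subgroup.one_closed)
  then have "gen \<one> \<subseteq> H" using gen_subset_iff H_in_I by blast
  moreover have "H \<subseteq> gen \<one>" using gen_in_I by (simp add: carrier_group_interval)
  ultimately show ?case using one by blast
next
  case (insert i T)
  have TS: "insert i T \<subseteq> S" using insert.prems f_subset by blast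
  \<comment> \<open>\<open>A\<close> and the atom \<open>B\<close> are complements in the interval
    from \<open>H\<close> to \<open>K\<close>: their images \<open>T\<close> and \<open>{i}\<close>
    partition \<open>f K\<close>.\<close>
  obtain A where A: "A \<in> carrier I" "f A = T" using f_surj TS by blast
  obtain B where B: "B \<in> carrier I" "f B = {i}" using f_surj[of "{i}"] TS by blast
  obtain a where a: "a \<in> A" "gen a = A" using insert.IH A by blast
  have "B \<noteq> H" using B f_H by auto
  then obtain b where b: "b \<in> B" "b \<notin> H" using B by (auto simp: carrier_group_interval)
  have "f A \<subseteq> f K" "f B \<subseteq> f K" using A B insert.prems by auto
  then have AK: "A \<subseteq> K" and BK: "B \<subseteq> K" using f_mono_iff[OF _ insert.prems(1)] A(1) B(1) by blast+
  have K: "subgroup K G" using insert.prems by (simp add: carrier_group_interval)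
  have abK: "a \<in> K" "b \<in> K" "a \<otimes> b \<in> K" using a b AK BK subgroup.m_closed[OF K] by auto
  then have abG: "a \<in> carrier G" "b \<in> carrier G" "a \<otimes> b \<in> carrier G"
    using subgroup.subset[OF K] by auto
  \<comment> \<open>Nothing lies strictly between \<open>H\<close> and an atom, so any element of
    \<open>B\<close> outside \<open>H\<close> generates \<open>B\<close> over
    \<open>H\<close>.\<close>
  have genb: "gen b = B"
  proof -
    have g: "gen b \<in> carrier I" using abG gen_in_I by blast
    have "gen b \<subseteq> B" using gen_subset_iff[OF B(1)] b(1) by blast
    then have "f (gen b) \<subseteq> {i}" using f_mono_iff[OF g B(1)] B by simp
    moreover have "f (gen b) \<noteq> {}"
    proof
      assume "f (gen b) = {}"
      then have "gen b = H" using f_eq_iff[OF g H_in_I] f_H by simp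
      then show False using gen_subset_iff[OF H_in_I] b(2) by blast
    qed
    ultimately have "f (gen b) = f B" using B(2) subset_singletonD by metis
    then show ?thesis using f_eq_iff[OF g B(1)] by simp
  qed
  let ?X = "gen (a \<otimes> b)"
  have X: "?X \<in> carrier I" using abG gen_in_I by blast
  have XK: "?X \<subseteq> K" using gen_subset_iff[OF insert.prems(1)] abK(3) by blast
  have "i \<in> f ?X"
  proof -
    \<comment> \<open>\<open>Y\<close> is the join of \<open>?X\<close> and \<open>A\<close>. It
      contains \<open>a\<close> and \<open>a \<otimes> b\<close>, hence \<open>b\<close>, hence
      \<open>B\<close>; as \<open>i \<notin> T\<close>, the point \<open>i\<close> must come from
      \<open>?X\<close>.\<close>
    obtain Y where Y: "Y \<in> carrier I" "f Y = f ?X \<union> f A"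
      using f_surj[of "f ?X \<union> f A"] f_subset X A by blast
    then have "?X \<subseteq> Y" "A \<subseteq> Y" by (simp_all add: X A flip: f_mono_iff)
    then have "a \<otimes> b \<in> Y" "a \<in> Y" using gen_subset_iff[OF Y(1)] a(1) by blast+
    moreover have "subgroup Y G" using Y by (simp add: carrier_group_interval)
    ultimately have "inv a \<otimes> (a \<otimes> b) \<in> Y" by (simp add: subgroup.m_closed subgroup.m_inv_closed)
    then have "b \<in> Y" using abG by (simp add: m_assoc[symmetric])
    then have "B \<subseteq> Y" using gen_subset_iff[OF Y(1), of b] genb by simp
    then have "{i} \<subseteq> f ?X \<union> T" using f_mono_iff[OF B(1) Y(1)] A B Y by simp
    then show ?thesis using insert.hyps by blast
  qed
  moreover have "T \<subseteq> f ?X"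
  proof -
    \<comment> \<open>Symmetrically, the join of \<open>?X\<close> and \<open>B\<close> contains
      \<open>a\<close>, so it contains \<open>A\<close>; every point of \<open>T\<close> differs
      from \<open>i\<close> and so comes from \<open>?X\<close>.\<close>
    obtain Y where Y: "Y \<in> carrier I" "f Y = f ?X \<union> f B"
      using f_surj[of "f ?X \<union> f B"] f_subset X B by blast
    then have "?X \<subseteq> Y" "B \<subseteq> Y" by (simp_all add: X B subset_insertI flip: f_mono_iff)
    then have "a \<otimes> b \<in> Y" "b \<in> Y" using gen_subset_iff[OF Y(1)] b(1) by blast+
    moreover have "subgroup Y G" using Y by (simp add: carrier_group_interval)
    ultimately have "(a \<otimes> b) \<otimes> inv b \<in> Y" by (simp add: subgroup.m_closed subgroup.m_inv_closed)
    then have "a \<in> Y" using abG by (simp add: m_assoc)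
    then have "A \<subseteq> Y" using gen_subset_iff[OF Y(1), of a] a by simp
    then have "T \<subseteq> f ?X \<union> {i}" using f_mono_iff[OF A(1) Y(1)] A B Y by simp
    then show ?thesis using insert.hyps by blast
  qed
  ultimately have "f K \<subseteq> f ?X" using insert.prems by simp
  then have "?X = K" using f_mono_iff[OF insert.prems(1) X] XK by blast
  then show ?case using abK by blast
qed

section \<open>Counting generators\<close>

lemma finite_interval: "finite (carrier I)"
  by (rule finite_subset[of _ "Pow (carrier G)"])
    (use finite_carrier in \<open>auto simp: carrier_group_interval dest!: subgroup.subset\<close>)

text \<open>The product formula with \<open>K <#> compl K\<close> equal to the group and
  \<open>K \<inter> compl K = H\<close>, combined with Lagrange; then the nonzero factor
  \<open>card K\<close> is cancelled.\<close>

lemma card_compl: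
  assumes gc: "group_complemented H G" and K: "K \<in> carrier I"
  shows "card (compl K) = card (rcosets K) * card H"
proof -
  have sub: "subgroup K G" "subgroup (compl K) G"
    using K compl_in_I by (auto simp: carrier_group_interval)
  have fin: "finite K" "finite (compl K)"
    using sub finite_carrier by (meson finite_subset subgroup.subset)+
  have "card K * card (compl K) = card (carrier G) * card H"
    using card_subgroup_product[OF sub fin] gc K Int_compl by (simp add: group_complemented_def)
  also have "\<dots> = card K * (card (rcosets K) * card H)"
    using lagrange[OF sub(1)] by (simp add: order_def mult.commute mult.left_commute)
  finally have "card K * card (compl K) = card K * (card (rcosets K) * card H)" .
  moreover have "card K \<noteq> 0" using fin subgroup.one_closed[OF sub(1)] by auto
  ultimately show ?thesis by (metis mult_left_cancel)
qed

text \<open>The factor \<open>card H\<close> turns each index into the order of a complement, whose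
  elements can be counted one by one after exchanging the sums.\<close>

lemma dual_totient_eq_card_generators:
  assumes gc: "group_complemented H G"
  shows "int (card H) * dual_totient H G = int (card {g \<in> carrier G. gen g = carrier G})"
proof -
  have inner: "(\<Sum>K \<in> {K \<in> carrier I. g \<in> compl K}. moebius I H K) =
      (if gen g = carrier G then 1 else 0)"
    if "g \<in> carrier G" for g
  proof -
    have g: "gen g \<in> carrier I" using that by (rule gen_in_I)
    have "{K \<in> carrier I. g \<in> compl K} =
        {K. K \<in> carrier I \<and> H \<sqsubseteq>\<^bsub>I\<^esub> K \<and> K \<sqsubseteq>\<^bsub>I\<^esub> compl (gen g)}"
    proof (intro Collect_cong conj_cong refl)
      fix K assume K: "K \<in> carrier I"
      have "g \<in> compl K \<longleftrightarrow> K \<subseteq> compl (gen g)"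
        using gen_subset_iff[OF compl_in_I[OF K]] le_compl_iff[OF K g] by blast
      moreover have "H \<subseteq> K" using K by (simp add: carrier_group_interval)
      ultimately show "g \<in> compl K \<longleftrightarrow> H \<sqsubseteq>\<^bsub>I\<^esub> K \<and> K \<sqsubseteq>\<^bsub>I\<^esub> compl (gen g)"
        by (simp add: le_group_interval)
    qed
    moreover have "H \<sqsubseteq>\<^bsub>I\<^esub> compl (gen g)"
      using compl_in_I[OF g] by (simp add: le_group_interval carrier_group_interval)
    \<comment> \<open>The Moebius sum from \<open>H\<close> up to \<open>compl (gen g)\<close> is
      nonzero only if these coincide, that is, if \<open>gen g\<close> is the whole group.\<close>
    ultimately show ?thesis
      using sum_moebius[OF partial_order_group_interval finite_interval H_in_I compl_in_I[OF g]]
        compl_eq_H_iff[OF g] by (simp add: eq_commute[of H])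
  qed
  have "int (card H) * dual_totient H G = (\<Sum>K \<in> carrier I. moebius I H K * int (card (compl K)))"
    by (simp add: dual_totient_def sum_distrib_left card_compl[OF gc] mult_ac)
  also have "\<dots> = (\<Sum>K \<in> carrier I. \<Sum>g \<in> {g \<in> carrier G. g \<in> compl K}. moebius I H K)"
  proof (rule sum.cong[OF refl])
    fix K assume "K \<in> carrier I"
    then have "compl K \<subseteq> carrier G"
      using compl_in_I by (simp add: carrier_group_interval subgroup.subset)
    then have "{g \<in> carrier G. g \<in> compl K} = compl K" by blast
    then show "moebius I H K * int (card (compl K)) =
        (\<Sum>g \<in> {g \<in> carrier G. g \<in> compl K}. moebius I H K)" by simp
  qed
  also have "\<dots> = (\<Sum>g \<in> carrier G. \<Sum>K \<in> {K \<in> carrier I. g \<in> compl K}. moebius I H K)"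
    by (rule sum.swap_restrict[OF finite_interval finite_carrier])
  also have "\<dots> = (\<Sum>g \<in> carrier G. if gen g = carrier G then 1 else 0)"
    using inner by simp
  also have "\<dots> = int (card {g \<in> carrier G. gen g = carrier G})"
    using finite_carrier by (simp add: sum.If_cases Int_def)
  finally show ?thesis .
qed

end

theorem corollary3p17:
  fixes G :: "('a, 'b) monoid_scheme" and H :: "'a set"
  assumes "group G" and "finite (carrier G)" and "subgroup H G"
    and "boolean_lattice (group_interval H G)"
    and "group_complemented H G"
  shows "dual_totient H G > 0"
proof -
  obtain S :: "nat set" and f where "finite S" "bij_betw f (carrier (group_interval H G)) (Pow S)"
    "order_emb (group_interval H G) \<lparr>carrier = Pow S, eq = (=), le = (\<subseteq>)\<rparr> f"
    using assms(4) unfolding boolean_lattice_def by blast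
  then interpret boolean_group_interval G H S f
    using assms by (intro boolean_group_interval.intro boolean_group_interval_axioms.intro)
  \<comment> \<open>Ore's theorem at the top of the interval, where \<open>f\<close> takes the value
    \<open>S\<close>.\<close>
  have "{g \<in> carrier G. gen g = carrier G} \<noteq> {}"
    using gen_surj[OF finite_S G_in_I f_G] by blast
  then have "int (card H) * dual_totient H G > 0"
    using dual_totient_eq_card_generators[OF assms(5)] finite_carrier
    by (simp add: card_gt_0_iff)
  then show ?thesis by (simp add: zero_less_mult_iff)
qed

end
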